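(* Let $n\ge 2$. Among all trees $T$ of order $n$ and all vertices $r\in V(T)$, the minimum value of $RC(r)$ is $n-1$, and it is attained when $T$ is a star and $r$ is its centre.
   Context: The simple random walk moves at each step to a uniformly random neighbour; $H_{vw}$ is the expected number of steps for the walk started at $v$ to first reach $w$ ($H_{vv}=0$). The reverse cover cost is $RC(r)=\sum_{w\in V(T)} H_{wr}$. *)

theory Defs
  imports "HOL-Probability.Probability" "Graph_Theory.Graph_Theory"
begin

text \<open>
  A finite simple graph is a \<^locale>\<open>pair_graph\<close>: a symmetric loop-free set of arcs.
  The constant \<^const>\<open>tree\<close> is not usable for such graphs, because it counts the closed
  walk \<open>u, v, u\<close> along the two arcs of a single edge as a cycle. The cycles of the undirected
  graph are the directed cycles of length at least 3.
\<close>

definition undirected_tree :: "'a pair_pre_digraph \<Rightarrow> bool" where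
  "undirected_tree G \<longleftrightarrow>
     pair_graph G \<and>
     Digraph_Component.connected (with_proj G) \<and>
     (\<nexists>p. pre_digraph.cycle (with_proj G) p \<and> 3 \<le> length p)"

definition star_with_centre :: "'a pair_pre_digraph \<Rightarrow> 'a \<Rightarrow> bool" where
  "star_with_centre G r \<longleftrightarrow>
     finite (pverts G) \<and> r \<in> pverts G \<and>
     parcs G = {r} \<times> (pverts G - {r}) \<union> (pverts G - {r}) \<times> {r}"

text \<open>
  Only meaningful at vertices with at least one and finitely many neighbours,
  which covers every vertex of a finite tree of order at least 2.
\<close>

definition srw_step :: "'a pair_pre_digraph \<Rightarrow> 'a \<Rightarrow> 'a pmf" where
  "srw_step G v = pmf_of_set {w. (v, w) \<in> parcs G}"

text \<open>The law of position \<open>i\<close> of the walk from \<open>v\<close>, given the positions before time \<open>i\<close>.\<close>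

definition srw_kernel :: "'a pair_pre_digraph \<Rightarrow> 'a \<Rightarrow> nat \<Rightarrow> (nat \<Rightarrow> 'a) \<Rightarrow> 'a measure" where
  "srw_kernel G v i \<omega> =
     measure_pmf (case i of 0 \<Rightarrow> return_pmf v | Suc j \<Rightarrow> srw_step G (\<omega> j))"

lemma Ionescu_Tulcea_srw: "Ionescu_Tulcea (srw_kernel G v) (\<lambda>_. count_space UNIV)"
proof (rule Ionescu_Tulcea.intro)
  fix i
  show "srw_kernel G v i \<in>
      measurable (PiM {0..<i} (\<lambda>_. count_space UNIV)) (subprob_algebra (count_space UNIV))"
  proof (cases i)
    case 0
    then show ?thesis
      by (simp add: srw_kernel_def[abs_def] measure_pmf_in_subprob_algebra)
  next
    case (Suc j)
    have "(\<lambda>\<omega>. \<omega> j) \<in> measurable (PiM {0..<i} (\<lambda>_. count_space UNIV)) (count_space UNIV)"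
      using Suc by (intro measurable_component_singleton) auto
    moreover have "(\<lambda>x. measure_pmf (srw_step G x)) \<in>
        measurable (count_space UNIV) (subprob_algebra (count_space UNIV))"
      by (simp add: measure_pmf_in_subprob_algebra)
    ultimately show ?thesis
      using Suc by (simp add: srw_kernel_def[abs_def] measurable_compose)
  qed
next
  fix i \<omega>
  show "prob_space (srw_kernel G v i \<omega>)"
    by (simp add: srw_kernel_def measure_pmf.prob_space_axioms)
qed

text \<open>The law, on trajectories, of the simple random walk on \<open>G\<close> started at \<open>v\<close>.\<close>

definition srw :: "'a pair_pre_digraph \<Rightarrow> 'a \<Rightarrow> (nat \<Rightarrow> 'a) measure" where
  "srw G v =
     projective_family.lim UNIV
       (Ionescu_Tulcea.CI (srw_kernel G v) (\<lambda>_. count_space UNIV))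
       (\<lambda>_. count_space UNIV)"

lemma prob_space_srw: "prob_space (srw G v)"
proof -
  interpret Ionescu_Tulcea "srw_kernel G v" "\<lambda>_. count_space UNIV"
    by (rule Ionescu_Tulcea_srw)
  have "emeasure PF.lim (PF.emb UNIV {} {\<lambda>_. undefined}) = emeasure (CI {}) {\<lambda>_. undefined}"
    by (rule lim) (auto simp: PiM_empty)
  moreover have "emeasure (CI {}) {\<lambda>_. undefined} = 1"
    using prob_space.emeasure_space_1[OF PF.prob_space_P[of "{}"]]
    by (simp add: PF.space_P space_PiM)
  moreover have "PF.emb UNIV {} {\<lambda>_. undefined} = space PF.lim"
    by (auto simp: prod_emb_def space_PiM PF.space_lim)
  ultimately show ?thesis
    unfolding srw_def by (intro prob_spaceI) simp
qed

definition first_hit :: "'a \<Rightarrow> (nat \<Rightarrow> 'a) \<Rightarrow> enat" where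
  "first_hit w \<omega> = (INF i\<in>{i. \<omega> i = w}. enat i)"

definition hitting_time :: "'a pair_pre_digraph \<Rightarrow> 'a \<Rightarrow> 'a \<Rightarrow> ennreal" where
  "hitting_time G v w = (\<integral>\<^sup>+ \<omega>. ennreal_of_enat (first_hit w \<omega>) \<partial>srw G v)"

definition reverse_cover_cost :: "'a pair_pre_digraph \<Rightarrow> 'a \<Rightarrow> ennreal" where
  "reverse_cover_cost G r = (\<Sum>w\<in>pverts G. hitting_time G w r)"

end

theory Submission
  imports Defs
begin

text \<open>
  A walk started at \<open>w \<noteq> r\<close> needs at least one step to reach \<open>r\<close>, so each of the \<open>n - 1\<close> vertices
  other than \<open>r\<close> contributes at least 1 to the reverse cover cost. In a star with centre \<open>r\<close> the
  first step from any other vertex leads to \<open>r\<close>, so every such contribution is exactly 1.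
\<close>

lemma (in Ionescu_Tulcea) AE_eP_iff:
  assumes \<omega>: "\<omega> \<in> space (PiM {0..<n} M)" and R: "Measurable.pred (PiM {0..<Suc n} M) R"
  shows "(AE \<omega>' in eP n \<omega>. R \<omega>') \<longleftrightarrow> (AE x in P n \<omega>. R (fun_upd \<omega> n x))"
proof -
  have "fun_upd \<omega> n \<in> P n \<omega> \<rightarrow>\<^sub>M PiM {0..<Suc n} M"
    using \<omega> by (intro measurable_fun_upd[where J = "{0..<n}"])
      (auto simp: measurable_cong_sets[OF sets_P[OF \<omega>] refl])
  then show ?thesis
    unfolding eP_def using R by (intro AE_distr_iff) (simp_all add: pred_def)
qed

lemma (in Ionescu_Tulcea) pred_AE_eP:
  assumes R: "Measurable.pred (PiM {0..<Suc n} M) R"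
  shows "Measurable.pred (PiM {0..<n} M) (\<lambda>\<omega>. AE \<omega>' in eP n \<omega>. R \<omega>')"
proof -
  let ?N = "{\<omega>' \<in> space (PiM {0..<Suc n} M). \<not> R \<omega>'}"
  have N: "?N \<in> sets (PiM {0..<Suc n} M)"
    using R by measurable
  then have "(\<lambda>\<omega>. emeasure (eP n \<omega>) ?N) \<in> borel_measurable (PiM {0..<n} M)"
    by (intro measurable_compose[OF measurable_eP] measurable_emeasure_subprob_algebra)
  then have "Measurable.pred (PiM {0..<n} M) (\<lambda>\<omega>. emeasure (eP n \<omega>) ?N = 0)"
    by measurable
  moreover have "emeasure (eP n \<omega>) ?N = 0 \<longleftrightarrow> (AE \<omega>' in eP n \<omega>. R \<omega>')"
    if "\<omega> \<in> space (PiM {0..<n} M)" for \<omega>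
    using that N by (intro AE_iff_measurable[symmetric]) (simp_all add: sets_eP space_eP)
  ultimately show ?thesis
    by (simp cong: measurable_cong)
qed

lemma (in Ionescu_Tulcea) distr_lim_atLeastLessThan:
  "distr PF.lim (PiM {0..<n} M) (\<lambda>\<omega>. restrict \<omega> {0..<n}) = C 0 n (\<lambda>_. undefined)"
proof -
  have "up_to {0..<n} \<le> n"
    by (simp add: up_to_iff)
  moreover have "n \<le> up_to {0..<n}"
    using up_to[of "{0..<n}"] by (cases "n = 0") simp_all
  ultimately have "up_to {0..<n} = n"
    by (rule antisym)
  then show ?thesis
    using distr_C[of n n "\<lambda>_. undefined" 0] by (simp add: distr_lim CI_def space_PiM)
qed

lemma (in Ionescu_Tulcea) AE_lim_restrict_iff:
  assumes "Measurable.pred (PiM {0..<n} M) R"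
  shows "(AE \<omega> in PF.lim. R (restrict \<omega> {0..<n})) \<longleftrightarrow> (AE \<omega> in C 0 n (\<lambda>_. undefined). R \<omega>)"
proof -
  have "(\<lambda>\<omega>. restrict \<omega> {0..<n}) \<in> PF.lim \<rightarrow>\<^sub>M PiM {0..<n} M"
    by (simp add: measurable_cong_sets[OF PF.sets_lim refl] measurable_restrict_subset)
  then show ?thesis
    unfolding distr_lim_atLeastLessThan[symmetric]
    using assms by (intro AE_distr_iff[symmetric]) (simp_all only: pred_def)
qed

lemma (in Ionescu_Tulcea) AE_lim_Suc_iff:
  assumes R: "Measurable.pred (PiM {0..<Suc n} M) R"
  shows "(AE \<omega> in PF.lim. R (restrict \<omega> {0..<Suc n})) \<longleftrightarrow>
    (AE \<omega> in PF.lim. AE x in P n (restrict \<omega> {0..<n}). R (fun_upd (restrict \<omega> {0..<n}) n x))"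
proof -
  have "(AE \<omega> in PF.lim. R (restrict \<omega> {0..<Suc n})) \<longleftrightarrow>
      (AE \<omega>' in C 0 n (\<lambda>_. undefined) \<bind> eP n. R \<omega>')"
    by (rule AE_lim_restrict_iff[OF R, unfolded C.simps add_0])
  also have "\<dots> \<longleftrightarrow> (AE \<omega> in C 0 n (\<lambda>_. undefined). AE \<omega>' in eP n \<omega>. R \<omega>')"
  proof (rule AE_bind[OF _ R])
    show "eP n \<in> C 0 n (\<lambda>_. undefined) \<rightarrow>\<^sub>M subprob_algebra (PiM {0..<Suc n} M)"
      using measurable_eP sets_C[of "\<lambda>_. undefined" 0 n]
      by (simp add: space_PiM cong: measurable_cong_sets)
  qed
  also have "\<dots> \<longleftrightarrow> (AE \<omega> in PF.lim. AE \<omega>' in eP n (restrict \<omega> {0..<n}). R \<omega>')"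
    by (rule AE_lim_restrict_iff[OF pred_AE_eP[OF R], symmetric])
  also have "\<dots> \<longleftrightarrow>
      (AE \<omega> in PF.lim. AE x in P n (restrict \<omega> {0..<n}). R (fun_upd (restrict \<omega> {0..<n}) n x))"
  proof (rule AE_cong)
    fix \<omega> assume "\<omega> \<in> space PF.lim"
    then have "restrict \<omega> {0..<n} \<in> space (PiM {0..<n} M)"
      by (auto simp: space_PiM)
    then show "(AE \<omega>' in eP n (restrict \<omega> {0..<n}). R \<omega>') \<longleftrightarrow>
        (AE x in P n (restrict \<omega> {0..<n}). R (fun_upd (restrict \<omega> {0..<n}) n x))"
      by (rule AE_eP_iff[OF _ R])
  qed
  finally show ?thesis .
qed

lemma AE_srw_restrict_Suc_iff:
  assumes "Measurable.pred (PiM {0..<Suc n} (\<lambda>_. count_space UNIV)) R"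
  shows "(AE \<omega> in srw G v. R (restrict \<omega> {0..<Suc n})) \<longleftrightarrow>
    (AE \<omega> in srw G v. AE x in srw_kernel G v n (restrict \<omega> {0..<n}).
      R (fun_upd (restrict \<omega> {0..<n}) n x))"
  unfolding srw_def using assms by (rule Ionescu_Tulcea.AE_lim_Suc_iff[OF Ionescu_Tulcea_srw])

lemma AE_srw_kernel_0_iff: "(AE x in srw_kernel G v 0 \<omega>. R x) \<longleftrightarrow> R v"
  unfolding srw_kernel_def AE_measure_pmf_iff by simp

lemma AE_srw_kernel_Suc_iff:
  "(AE x in srw_kernel G v (Suc i) \<omega>. R x) \<longleftrightarrow> (\<forall>x\<in>set_pmf (srw_step G (\<omega> i)). R x)"
  unfolding srw_kernel_def AE_measure_pmf_iff by simp

lemma AE_srw_0: "AE \<omega> in srw G v. \<omega> 0 = v"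
proof -
  have "Measurable.pred (PiM {0..<Suc 0} (\<lambda>_. count_space UNIV)) (\<lambda>\<omega>. \<omega> 0 = v)"
    by measurable
  from AE_srw_restrict_Suc_iff[OF this, of G v] show ?thesis
    by (simp add: AE_srw_kernel_0_iff)
qed

text \<open>
  For uncountable \<^typ>\<open>'a\<close> the set of all \<open>\<omega>\<close> with \<open>\<omega> (Suc i) \<in> set_pmf (srw_step G (\<omega> i))\<close> need
  not be measurable in the product space; it becomes so once \<open>\<omega> i\<close> is confined to a countable set.
\<close>

lemma AE_srw_Suc_if_countable:
  assumes S: "countable S" "AE \<omega> in srw G v. \<omega> i \<in> S"
  shows "AE \<omega> in srw G v. \<omega> (Suc i) \<in> set_pmf (srw_step G (\<omega> i))"
proof -
  let ?step = "\<lambda>\<omega>. \<exists>u\<in>S. \<omega> i = u \<and> \<omega> (Suc i) \<in> set_pmf (srw_step G u)"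
  have "Measurable.pred (PiM {0..<Suc (Suc i)} (\<lambda>_. count_space UNIV)) ?step"
    using S(1) by measurable
  moreover have "AE \<omega> in srw G v. AE x in srw_kernel G v (Suc i) (restrict \<omega> {0..<Suc i}).
      ?step (fun_upd (restrict \<omega> {0..<Suc i}) (Suc i) x)"
    using S(2) by eventually_elim (simp add: AE_srw_kernel_Suc_iff)
  ultimately have "AE \<omega> in srw G v. ?step (restrict \<omega> {0..<Suc (Suc i)})"
    by (rule AE_srw_restrict_Suc_iff[THEN iffD2])
  then show ?thesis
    by eventually_elim auto
qed

lemma AE_srw_in_countable: "\<exists>S. countable S \<and> (AE \<omega> in srw G v. \<omega> i \<in> S)"
proof (induction i)
  case 0
  have "countable {v}" "AE \<omega> in srw G v. \<omega> 0 \<in> {v}"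
    using AE_srw_0 by simp_all
  then show ?case by blast
next
  case (Suc i)
  then obtain S where S: "countable S" "AE \<omega> in srw G v. \<omega> i \<in> S"
    by blast
  let ?S' = "\<Union>u\<in>S. set_pmf (srw_step G u)"
  have "AE \<omega> in srw G v. \<omega> (Suc i) \<in> ?S'"
    using S(2) AE_srw_Suc_if_countable[OF S] by eventually_elim blast
  moreover have "countable ?S'"
    using S(1) by simp
  ultimately show ?case by blast
qed

lemma AE_srw_Suc: "AE \<omega> in srw G v. \<omega> (Suc i) \<in> set_pmf (srw_step G (\<omega> i))"
proof -
  obtain S where "countable S" "AE \<omega> in srw G v. \<omega> i \<in> S"
    using AE_srw_in_countable[where G = G and v = v and i = i] by auto
  then show ?thesis
    by (rule AE_srw_Suc_if_countable)
qed

lemma le_first_hit_iff: "enat k \<le> first_hit w \<omega> \<longleftrightarrow> (\<forall>i<k. \<omega> i \<noteq> w)"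
  unfolding first_hit_def le_INF_iff by (auto simp: not_less[symmetric])

lemma first_hit_eqI:
  assumes "\<omega> k = w" and "\<And>i. i < k \<Longrightarrow> \<omega> i \<noteq> w"
  shows "first_hit w \<omega> = enat k"
proof (rule antisym)
  show "first_hit w \<omega> \<le> enat k"
    unfolding first_hit_def using assms(1) by (intro INF_lower) simp
  show "enat k \<le> first_hit w \<omega>"
    using assms(2) by (simp add: le_first_hit_iff)
qed

lemma nn_integral_srw_const: "(\<integral>\<^sup>+ \<omega>. c \<partial>srw G v) = c"
  by (simp add: prob_space.emeasure_space_1[OF prob_space_srw])

lemma hitting_time_geI:
  assumes "AE \<omega> in srw G v. k \<le> first_hit w \<omega>"
  shows "ennreal_of_enat k \<le> hitting_time G v w"
proof -
  have "ennreal_of_enat k = (\<integral>\<^sup>+ \<omega>. ennreal_of_enat k \<partial>srw G v)"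
    by (simp only: nn_integral_srw_const)
  also have "\<dots> \<le> hitting_time G v w"
    unfolding hitting_time_def using assms by (intro nn_integral_mono_AE) simp
  finally show ?thesis .
qed

lemma hitting_time_eqI:
  assumes "AE \<omega> in srw G v. first_hit w \<omega> = k"
  shows "hitting_time G v w = ennreal_of_enat k"
proof -
  have "hitting_time G v w = (\<integral>\<^sup>+ \<omega>. ennreal_of_enat k \<partial>srw G v)"
    unfolding hitting_time_def using assms by (intro nn_integral_cong_AE) auto
  then show ?thesis
    by (simp only: nn_integral_srw_const)
qed

lemma hitting_time_self: "hitting_time G r r = 0"
proof -
  have "AE \<omega> in srw G r. first_hit r \<omega> = enat 0"
    using AE_srw_0 by eventually_elim (simp add: first_hit_eqI)
  then show ?thesis
    using hitting_time_eqI by fastforce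
qed

lemma hitting_time_ge_1:
  assumes "w \<noteq> r"
  shows "1 \<le> hitting_time G w r"
proof -
  have "AE \<omega> in srw G w. enat 1 \<le> first_hit r \<omega>"
    using AE_srw_0 by eventually_elim (simp add: le_first_hit_iff assms)
  then show ?thesis
    using hitting_time_geI by fastforce
qed

lemma hitting_time_unique_neighbour:
  assumes "w \<noteq> r" and "{u. (w, u) \<in> parcs G} = {r}"
  shows "hitting_time G w r = 1"
proof -
  have "AE \<omega> in srw G w. first_hit r \<omega> = enat 1"
    using AE_srw_0 AE_srw_Suc[where G = G and v = w and i = 0]
    by eventually_elim (intro first_hit_eqI; simp add: srw_step_def assms)
  then show ?thesis
    using hitting_time_eqI by fastforce
qed

lemma reverse_cover_cost_eq_sum_others:
  assumes "finite (pverts G)"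
  shows "reverse_cover_cost G r = (\<Sum>w\<in>pverts G - {r}. hitting_time G w r)"
  unfolding reverse_cover_cost_def using assms
  by (intro sum.mono_neutral_right) (auto simp: hitting_time_self)

lemma reverse_cover_cost_ge: "of_nat (card (pverts G) - 1) \<le> reverse_cover_cost G r"
proof (cases "finite (pverts G)")
  case True
  have "of_nat (card (pverts G) - 1) \<le> (of_nat (card (pverts G - {r})) :: ennreal)"
    by (simp add: card_Diff_singleton_if)
  also have "\<dots> = (\<Sum>w\<in>pverts G - {r}. 1)"
    by simp
  also have "\<dots> \<le> (\<Sum>w\<in>pverts G - {r}. hitting_time G w r)"
    by (intro sum_mono hitting_time_ge_1) simp
  also have "\<dots> = reverse_cover_cost G r"
    by (rule reverse_cover_cost_eq_sum_others[OF True, symmetric])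
  finally show ?thesis .
qed simp

lemma parcs_star_iff:
  assumes "star_with_centre G r"
  shows "(u, v) \<in> parcs G \<longleftrightarrow> u \<in> pverts G \<and> v \<in> pverts G \<and> (u = r) \<noteq> (v = r)"
  using assms unfolding star_with_centre_def by auto

lemma reverse_cover_cost_star:
  assumes "star_with_centre G r"
  shows "reverse_cover_cost G r = of_nat (card (pverts G) - 1)"
proof -
  have "finite (pverts G)" and "r \<in> pverts G"
    using assms by (auto simp: star_with_centre_def)
  have "hitting_time G w r = 1" if "w \<in> pverts G - {r}" for w
    using that \<open>r \<in> pverts G\<close>
    by (intro hitting_time_unique_neighbour) (auto simp: parcs_star_iff[OF assms])
  then have "reverse_cover_cost G r = (\<Sum>w\<in>pverts G - {r}. 1)"
    using \<open>finite (pverts G)\<close> by (simp add: reverse_cover_cost_eq_sum_others)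
  then show ?thesis
    using \<open>r \<in> pverts G\<close> by simp
qed

lemma (in pre_digraph) map_tail_snoc_if_cas:
  "cas u p v \<Longrightarrow> map (tail G) p @ [v] = u # map (head G) p"
  by (induction u p v rule: cas.induct) auto

lemma (in pre_digraph) distinct_heads_if_cycle: "cycle p \<Longrightarrow> distinct (map (head G) p)"
  by (auto simp: cycle_def awalk_def awalk_verts_conv')

lemma (in pre_digraph) distinct_tails_if_cycle:
  assumes "cycle p"
  shows "distinct (map (tail G) p)"
proof -
  from assms obtain u where "cas u p u"
    by (auto simp: cycle_def awalk_def)
  then have "mset (map (tail G) p @ [u]) = mset (u # map (head G) p)"
    by (simp only: map_tail_snoc_if_cas)
  then have "mset (map (tail G) p) = mset (map (head G) p)"
    by simp
  then show ?thesis
    using distinct_heads_if_cycle[OF assms] mset_eq_imp_distinct_iff by blast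
qed

lemma length_filter_eq_le_1_if_distinct:
  assumes "distinct (map f xs)"
  shows "length (filter (\<lambda>x. f x = y) xs) \<le> 1"
  using assms
proof (induction xs)
  case (Cons a xs)
  have "f x \<noteq> f a" if "x \<in> set xs" for x
    using Cons.prems imageI[OF that, of f] by auto
  then have "filter (\<lambda>x. f x = f a) xs = []"
    by (simp add: filter_empty_conv)
  with Cons show ?case by auto
qed simp

text \<open>A cycle leaves the vertex \<open>r\<close> at most once and enters it at most once.\<close>

lemma (in pre_digraph) length_cycle_le_2_if_all_arcs_incident:
  assumes "cycle p" and incident: "\<And>e. e \<in> set p \<Longrightarrow> tail G e = r \<or> head G e = r"
  shows "length p \<le> 2"
proof -
  have "length p \<le> length (filter (\<lambda>e. tail G e = r) p) + length (filter (\<lambda>e. head G e = r) p)"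
    using incident by (induction p) fastforce+
  also have "\<dots> \<le> 1 + 1"
    using distinct_tails_if_cycle[OF \<open>cycle p\<close>] distinct_heads_if_cycle[OF \<open>cycle p\<close>]
    by (intro add_mono length_filter_eq_le_1_if_distinct)
  finally show ?thesis by simp
qed

lemma pair_graph_star:
  assumes "star_with_centre G r"
  shows "pair_graph G"
proof -
  have star: "parcs G = {r} \<times> (pverts G - {r}) \<union> (pverts G - {r}) \<times> {r}"
    "finite (pverts G)" "r \<in> pverts G"
    using assms by (simp_all add: star_with_centre_def)
  show ?thesis
    by unfold_locales (auto simp: star symmetric_def sym_def)
qed

lemma connected_star:
  assumes "star_with_centre G r"
  shows "Digraph_Component.connected (with_proj G)"
proof -
  interpret pair_graph G
    using assms by (rule pair_graph_star)
  have centre: "r \<rightarrow>\<^sup>*\<^bsub>with_proj G\<^esub> u" "u \<rightarrow>\<^sup>*\<^bsub>with_proj G\<^esub> r" if "u \<in> pverts G" for u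
    using that assms by (cases "u = r"; auto simp: star_with_centre_def)+
  have "strongly_connected (with_proj G)"
    using assms reachable_trans[OF centre(2) centre(1)]
    by (auto simp: star_with_centre_def)
  then show ?thesis
    using reachable_mk_symmetric_eq[OF pair_sym_arcs]
    by (auto simp: connected_def strongly_connected_def)
qed

lemma undirected_tree_star:
  assumes "star_with_centre G r"
  shows "undirected_tree G"
proof -
  have "length p \<le> 2" if cycle: "pre_digraph.cycle (with_proj G) p" for p
  proof (rule pre_digraph.length_cycle_le_2_if_all_arcs_incident[OF cycle])
    fix e assume "e \<in> set p"
    with cycle have "e \<in> parcs G"
      by (auto simp: pre_digraph.cycle_def pre_digraph.awalk_def)
    then show "tail (with_proj G) e = r \<or> head (with_proj G) e = r"
      using parcs_star_iff[OF assms, of "fst e" "snd e"] by auto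
  qed
  then show ?thesis
    using pair_graph_star[OF assms] connected_star[OF assms]
    by (force simp: undirected_tree_def)
qed

lemma star_with_centre_exists:
  assumes "1 \<le> n"
  shows "\<exists>T :: nat pair_pre_digraph. star_with_centre T 0 \<and> card (pverts T) = n"
proof (intro exI conjI)
  let ?T = "\<lparr>pverts = {..<n}, parcs = {0} \<times> ({..<n} - {0}) \<union> ({..<n} - {0}) \<times> {0}\<rparr>"
  show "star_with_centre ?T 0"
    using assms by (simp add: star_with_centre_def)
  show "card (pverts ?T) = n"
    by simp
qed

theorem theorem15:
  fixes n :: nat
  assumes "2 \<le> n"
  shows "(\<forall>(T :: 'a pair_pre_digraph) r.
            undirected_tree T \<and> card (pverts T) = n \<and> r \<in> pverts T \<longrightarrow>
            of_nat (n - 1) \<le> reverse_cover_cost T r) \<and>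
         (\<forall>(T :: 'a pair_pre_digraph) r.
            star_with_centre T r \<and> card (pverts T) = n \<longrightarrow>
            undirected_tree T \<and> r \<in> pverts T \<and> reverse_cover_cost T r = of_nat (n - 1)) \<and>
         (\<exists>(T :: nat pair_pre_digraph) r.
            undirected_tree T \<and> star_with_centre T r \<and> card (pverts T) = n \<and>
            reverse_cover_cost T r = of_nat (n - 1))"
proof (intro conjI allI impI)
  fix T :: "'a pair_pre_digraph" and r
  assume "undirected_tree T \<and> card (pverts T) = n \<and> r \<in> pverts T"
  then show "of_nat (n - 1) \<le> reverse_cover_cost T r"
    using reverse_cover_cost_ge[of T r] by simp
next
  fix T :: "'a pair_pre_digraph" and r
  assume star: "star_with_centre T r \<and> card (pverts T) = n"
  then show "undirected_tree T" "reverse_cover_cost T r = of_nat (n - 1)"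
    by (auto simp: undirected_tree_star reverse_cover_cost_star)
  from star show "r \<in> pverts T"
    by (simp add: star_with_centre_def)
next
  obtain T :: "nat pair_pre_digraph" where star: "star_with_centre T 0" and "card (pverts T) = n"
    using star_with_centre_exists[of n] assms by auto
  then show "\<exists>(T :: nat pair_pre_digraph) r.
      undirected_tree T \<and> star_with_centre T r \<and> card (pverts T) = n \<and>
      reverse_cover_cost T r = of_nat (n - 1)"
    using undirected_tree_star[OF star] reverse_cover_cost_star[OF star] star by auto
qed

end
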